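(* In a plane fronted wave $\overline{M}^{n+2}$ there are no compact spacelike hypersurfaces $\psi:\Sigma^{n+1}\to\overline{M}^{n+2}$ with signed mean curvature, i.e., whose mean curvature function $H$ satisfies $H\geq 0$ everywhere on $\Sigma^{n+1}$ or $H\leq 0$ everywhere on $\Sigma^{n+1}$.
   Context: A plane fronted wave is a Lorentzian manifold $(\overline{M}^{n+2},\langle\ ,\ \rangle)$ with $\overline{M}^{n+2}=\mathbb{R}^2\times M^n$, where $(M^n,g_M)$ is a connected Riemannian manifold, and metric $\langle\ ,\ \rangle=\mathcal{H}(u,x)\,du\otimes du+du\otimes dv+dv\otimes du+g_M$, where $(u,v)$ are the natural coordinates on $\mathbb{R}^2$ and $\mathcal{H}(u,x)$ is a smooth function on $\mathbb{R}^2\times M^n$ independent of $v$. The coordinate vector field $\partial_v=\partial/\partial v$ is lightlike and parallel, and the spacetime is time-oriented by $\partial_v$. A spacelike hypersurface is an immersion $\psi:\Sigma^{n+1}\to\overline{M}^{n+2}$ of a connected $(n+1)$-dimensional manifold (without boundary) whose induced metric is Riemannian. Its mean curvature vector field is $\overrightarrow{H}=\frac1{n+1}\,\mathrm{trace}(\mathrm{II})$, where $\mathrm{II}$ is the second fundamental form, defined by $\overline{\nabla}_XY=\nabla_XY+\mathrm{II}(X,Y)$, with $\overline\nabla$, $\nabla$ the Levi-Civita connections of $\overline{M}^{n+2}$ and $\Sigma^{n+1}$. Let $N$ be the unit timelike normal vector field along $\psi$ with $\langle N,\partial_v\rangle<0$; the mean curvature function $H$ is defined by $\overrightarrow{H}=H\,N$.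 *)

theory Defs
  imports "HOL-Analysis.Analysis"
begin

section \<open>Smooth maps between open subsets of Euclidean spaces\<close>

text \<open>Both predicates are meant for open sets only: the derivatives are taken at the points of
  the set, with respect to full neighbourhoods.\<close>

primrec Ck_on :: "nat \<Rightarrow> 'a::euclidean_space set \<Rightarrow> ('a \<Rightarrow> 'b::euclidean_space) \<Rightarrow> bool" where
  "Ck_on 0 S f \<longleftrightarrow> continuous_on S f"
| "Ck_on (Suc k) S f \<longleftrightarrow>
     (\<forall>x\<in>S. f differentiable (at x)) \<and>
     (\<forall>v. Ck_on k S (\<lambda>x. frechet_derivative f (at x) v))"

definition smooth_on :: "'a::euclidean_space set \<Rightarrow> ('a \<Rightarrow> 'b::euclidean_space) \<Rightarrow> bool" where
  "smooth_on S f \<longleftrightarrow> (\<forall>k. Ck_on k S f)"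


section \<open>Smooth manifolds\<close>

text \<open>A chart is a pair of its domain and its coordinate map; the values of the coordinate map
  outside the domain are irrelevant. The dimension of a manifold modelled on the type \<open>'e\<close> is
  \<open>DIM('e)\<close>.\<close>

type_synonym ('m, 'e) chart = "'m set \<times> ('m \<Rightarrow> 'e)"

definition cdom :: "('m, 'e) chart \<Rightarrow> 'm set" where
  "cdom c = fst c"

definition cmap :: "('m, 'e) chart \<Rightarrow> 'm \<Rightarrow> 'e" where
  "cmap c = snd c"

definition cimg :: "('m, 'e) chart \<Rightarrow> 'e set" where
  "cimg c = cmap c ` cdom c"

definition cinv :: "('m, 'e) chart \<Rightarrow> 'e \<Rightarrow> 'm" where
  "cinv c = inv_into (cdom c) (cmap c)"

definition is_chart :: "'m topology \<Rightarrow> ('m, 'e::euclidean_space) chart \<Rightarrow> bool" where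
  "is_chart X c \<longleftrightarrow>
     openin X (cdom c) \<and> open (cimg c) \<and>
     homeomorphic_map (subtopology X (cdom c)) (top_of_set (cimg c)) (cmap c)"

text \<open>The local expression of \<open>f\<close> in a chart \<open>c\<close> of the source and a chart \<open>d\<close> of the target,
  and the open set on which it is meaningful.\<close>

definition local_rep ::
    "('m, 'e) chart \<Rightarrow> ('k, 'h) chart \<Rightarrow> ('m \<Rightarrow> 'k) \<Rightarrow> 'e \<Rightarrow> 'h" where
  "local_rep c d f = cmap d \<circ> f \<circ> cinv c"

definition local_dom ::
    "('m, 'e) chart \<Rightarrow> ('k, 'h) chart \<Rightarrow> ('m \<Rightarrow> 'k) \<Rightarrow> 'e set" where
  "local_dom c d f = cmap c ` {p \<in> cdom c. f p \<in> cdom d}"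

record ('m, 'e) manifold =
  mtop :: "'m topology"
  atlas :: "('m, 'e) chart set"

definition smooth_manifold :: "('m, 'e::euclidean_space, 'z) manifold_scheme \<Rightarrow> bool" where
  "smooth_manifold M \<longleftrightarrow>
     topspace (mtop M) \<noteq> {} \<and> Hausdorff_space (mtop M) \<and> second_countable (mtop M) \<and>
     (\<forall>c\<in>atlas M. is_chart (mtop M) c) \<and>
     (\<Union>c\<in>atlas M. cdom c) = topspace (mtop M) \<and>
     (\<forall>c\<in>atlas M. \<forall>d\<in>atlas M. smooth_on (local_dom c d id) (local_rep c d id))"

definition smooth_map ::
    "('m, 'e::euclidean_space, 'y) manifold_scheme \<Rightarrow>
     ('k, 'h::euclidean_space, 'z) manifold_scheme \<Rightarrow> ('m \<Rightarrow> 'k) \<Rightarrow> bool" where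
  "smooth_map M N f \<longleftrightarrow>
     continuous_map (mtop M) (mtop N) f \<and>
     (\<forall>c\<in>atlas M. \<forall>d\<in>atlas N. smooth_on (local_dom c d f) (local_rep c d f))"

definition smooth_function ::
    "('m, 'e::euclidean_space, 'z) manifold_scheme \<Rightarrow> ('m \<Rightarrow> real) \<Rightarrow> bool" where
  "smooth_function M f \<longleftrightarrow> (\<forall>c\<in>atlas M. smooth_on (cimg c) (f \<circ> cinv c))"

definition immersion ::
    "('m, 'e::euclidean_space, 'y) manifold_scheme \<Rightarrow>
     ('k, 'h::euclidean_space, 'z) manifold_scheme \<Rightarrow> ('m \<Rightarrow> 'k) \<Rightarrow> bool" where
  "immersion M N f \<longleftrightarrow>
     smooth_map M N f \<and>
     (\<forall>c\<in>atlas M. \<forall>d\<in>atlas N. \<forall>x\<in>local_dom c d f.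
        inj (frechet_derivative (local_rep c d f) (at x)))"

text \<open>Some chart of the atlas around \<open>p\<close>. It is used below only to evaluate expressions whose
  value does not depend on the choice of the chart.\<close>

definition chart_at :: "('m, 'e, 'z) manifold_scheme \<Rightarrow> 'm \<Rightarrow> ('m, 'e) chart" where
  "chart_at M p = (SOME c. c \<in> atlas M \<and> p \<in> cdom c)"


section \<open>Metrics\<close>

text \<open>A metric tensor is given by its local expressions: \<open>g c x\<close> is the bilinear form on the
  model space which represents, in the chart \<open>c\<close>, the tensor at the point with coordinates
  \<open>x \<in> cimg c\<close>.\<close>

type_synonym ('m, 'e) metric_tensor = "('m, 'e) chart \<Rightarrow> 'e \<Rightarrow> 'e \<Rightarrow> 'e \<Rightarrow> real"

definition symmetric_tensor ::
    "('m, 'e::euclidean_space, 'z) manifold_scheme \<Rightarrow> ('m, 'e) metric_tensor \<Rightarrow> bool" where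
  "symmetric_tensor M g \<longleftrightarrow>
     (\<forall>c\<in>atlas M. \<forall>x\<in>cimg c. bilinear (g c x) \<and> (\<forall>v w. g c x v w = g c x w v)) \<and>
     (\<forall>c\<in>atlas M. \<forall>v w. smooth_on (cimg c) (\<lambda>x. g c x v w)) \<and>
     (\<forall>c\<in>atlas M. \<forall>d\<in>atlas M. \<forall>x\<in>local_dom c d id. \<forall>v w.
        g c x v w =
          g d (local_rep c d id x)
            (frechet_derivative (local_rep c d id) (at x) v)
            (frechet_derivative (local_rep c d id) (at x) w))"

definition riemannian_metric ::
    "('m, 'e::euclidean_space, 'z) manifold_scheme \<Rightarrow> ('m, 'e) metric_tensor \<Rightarrow> bool" where
  "riemannian_metric M g \<longleftrightarrow>
     symmetric_tensor M g \<and> (\<forall>c\<in>atlas M. \<forall>x\<in>cimg c. \<forall>v. v \<noteq> 0 \<longrightarrow> 0 < g c x v v)"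

record ('m, 'e) metric_manifold = "('m, 'e) manifold" +
  metric :: "('m, 'e) metric_tensor"

definition riemannian_manifold :: "('m, 'e::euclidean_space) metric_manifold \<Rightarrow> bool" where
  "riemannian_manifold M \<longleftrightarrow> smooth_manifold M \<and> riemannian_metric M (metric M)"


section \<open>The Levi-Civita connection\<close>

text \<open>In a chart with metric coefficients \<open>G\<close> a connection is \<open>\<nabla>\<^sub>X Y = DY(X) + \<Gamma>(X, Y)\<close> with
  \<open>\<Gamma>\<close> bilinear at each point. The Levi-Civita connection is the one that is torsion-free
  (\<open>\<Gamma>\<close> is symmetric) and metric (\<open>X \<langle>Y, Z\<rangle> = \<langle>\<nabla>\<^sub>X Y, Z\<rangle> + \<langle>Y, \<nabla>\<^sub>X Z\<rangle>\<close>, written for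
  coefficient-constant fields).\<close>

definition is_levi_civita ::
    "('e::euclidean_space \<Rightarrow> 'e \<Rightarrow> 'e \<Rightarrow> real) \<Rightarrow> 'e \<Rightarrow> ('e \<Rightarrow> 'e \<Rightarrow> 'e) \<Rightarrow> bool" where
  "is_levi_civita G x \<Gamma> \<longleftrightarrow>
     bilinear \<Gamma> \<and> (\<forall>u v. \<Gamma> u v = \<Gamma> v u) \<and>
     (\<forall>u v w. frechet_derivative (\<lambda>y. G y v w) (at x) u = G x (\<Gamma> u v) w + G x v (\<Gamma> u w))"

definition christoffel ::
    "('e::euclidean_space \<Rightarrow> 'e \<Rightarrow> 'e \<Rightarrow> real) \<Rightarrow> 'e \<Rightarrow> 'e \<Rightarrow> 'e \<Rightarrow> 'e" where
  "christoffel G x = (THE \<Gamma>. is_levi_civita G x \<Gamma>)"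

text \<open>Covariant derivative, in the direction \<open>u\<close> at \<open>x\<close>, of a vector field \<open>W\<close> along the map
  \<open>F\<close>, with respect to the Levi-Civita connection of the metric \<open>G\<close> on the target. For
  \<open>F = (\<lambda>y. y)\<close> it is the Levi-Civita connection itself.\<close>

definition cov_deriv_along ::
    "('e::euclidean_space \<Rightarrow> 'e \<Rightarrow> 'e \<Rightarrow> real) \<Rightarrow> ('f::euclidean_space \<Rightarrow> 'e) \<Rightarrow>
     ('f \<Rightarrow> 'e) \<Rightarrow> 'f \<Rightarrow> 'f \<Rightarrow> 'e" where
  "cov_deriv_along G F W x u =
     frechet_derivative W (at x) u +
     christoffel G (F x) (frechet_derivative F (at x) u) (W x)"


section \<open>Spacelike hypersurfaces and their mean curvature\<close>

definition induced_metric ::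
    "('m, 'e::euclidean_space) metric_manifold \<Rightarrow> ('s \<Rightarrow> 'm) \<Rightarrow>
     ('s, 'f::euclidean_space) metric_tensor" where
  "induced_metric N \<psi> c x v w =
     (let d = chart_at N (\<psi> (cinv c x)); F = local_rep c d \<psi>
      in metric N d (F x) (frechet_derivative F (at x) v) (frechet_derivative F (at x) w))"

definition spacelike_hypersurface ::
    "('m, 'e::euclidean_space) metric_manifold \<Rightarrow>
     ('s, 'f::euclidean_space) manifold \<Rightarrow> ('s \<Rightarrow> 'm) \<Rightarrow> bool" where
  "spacelike_hypersurface N S \<psi> \<longleftrightarrow>
     DIM('f) + 1 = DIM('e) \<and>
     smooth_manifold S \<and> connected_space (mtop S) \<and>
     immersion S N \<psi> \<and> riemannian_metric S (induced_metric N \<psi>)"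

text \<open>In coordinates, \<open>II(X, Y) = \<nabla>bar\<^sub>X (d\<psi> Y) - d\<psi> (\<nabla>\<^sub>X Y)\<close>, where \<open>F\<close> is the local
  expression of \<open>\<psi>\<close>, \<open>Gbar\<close> the ambient metric and \<open>G\<close> the induced one. The value at a
  point depends only on the values of \<open>X\<close> and \<open>Y\<close> there, so it is computed by extending the
  tangent vector \<open>v\<close> as a coefficient-constant field.\<close>

definition second_fundamental_form ::
    "('e::euclidean_space \<Rightarrow> 'e \<Rightarrow> 'e \<Rightarrow> real) \<Rightarrow> ('f::euclidean_space \<Rightarrow> 'f \<Rightarrow> 'f \<Rightarrow> real) \<Rightarrow>
     ('f \<Rightarrow> 'e) \<Rightarrow> 'f \<Rightarrow> 'f \<Rightarrow> 'f \<Rightarrow> 'e" where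
  "second_fundamental_form Gbar G F x u v =
     (let Y = (\<lambda>y::'f. v)
      in cov_deriv_along Gbar F (\<lambda>y. frechet_derivative F (at y) (Y y)) x u -
         frechet_derivative F (at x) (cov_deriv_along G (\<lambda>y. y) Y x u))"

definition orthonormal_basis_wrt ::
    "('f::euclidean_space \<Rightarrow> 'f \<Rightarrow> real) \<Rightarrow> 'f set \<Rightarrow> bool" where
  "orthonormal_basis_wrt b E \<longleftrightarrow>
     finite E \<and> span E = UNIV \<and> (\<forall>e\<in>E. \<forall>e'\<in>E. b e e' = (if e = e' then 1 else 0))"

definition trace_wrt ::
    "('f::euclidean_space \<Rightarrow> 'f \<Rightarrow> real) \<Rightarrow> ('f \<Rightarrow> 'f \<Rightarrow> 'e::real_vector) \<Rightarrow> 'e" where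
  "trace_wrt b T = (THE t. \<forall>E. orthonormal_basis_wrt b E \<longrightarrow> t = (\<Sum>e\<in>E. T e e))"

text \<open>The following vectors along \<open>\<psi>\<close> at the point \<open>p\<close> are given by their coordinates in the
  chart \<open>chart_at N (\<psi> p)\<close>.\<close>

definition mean_curvature_vector ::
    "('m, 'e::euclidean_space) metric_manifold \<Rightarrow>
     ('s, 'f::euclidean_space) manifold \<Rightarrow> ('s \<Rightarrow> 'm) \<Rightarrow> 's \<Rightarrow> 'e" where
  "mean_curvature_vector N S \<psi> p =
     (let c = chart_at S p; d = chart_at N (\<psi> p); x = cmap c p;
          G = induced_metric N \<psi> c
      in (1 / real DIM('f)) *\<^sub>R
         trace_wrt (G x) (second_fundamental_form (metric N d) G (local_rep c d \<psi>) x))"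

text \<open>Here \<open>T d y\<close> are the coordinates, in the chart \<open>d\<close> at the point \<open>y\<close>, of the vector field
  that defines the time orientation.\<close>

definition unit_normal ::
    "('m, 'e::euclidean_space) metric_manifold \<Rightarrow> (('m, 'e) chart \<Rightarrow> 'e \<Rightarrow> 'e) \<Rightarrow>
     ('s, 'f::euclidean_space) manifold \<Rightarrow> ('s \<Rightarrow> 'm) \<Rightarrow> 's \<Rightarrow> 'e" where
  "unit_normal N T S \<psi> p =
     (let c = chart_at S p; d = chart_at N (\<psi> p); x = cmap c p; F = local_rep c d \<psi>;
          b = metric N d (F x)
      in THE \<nu>. (\<forall>v. b \<nu> (frechet_derivative F (at x) v) = 0) \<and> b \<nu> \<nu> = -1 \<and> b \<nu> (T d (F x)) < 0)"

definition mean_curvature ::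
    "('m, 'e::euclidean_space) metric_manifold \<Rightarrow> (('m, 'e) chart \<Rightarrow> 'e \<Rightarrow> 'e) \<Rightarrow>
     ('s, 'f::euclidean_space) manifold \<Rightarrow> ('s \<Rightarrow> 'm) \<Rightarrow> 's \<Rightarrow> real" where
  "mean_curvature N T S \<psi> p =
     (THE H. mean_curvature_vector N S \<psi> p = H *\<^sub>R unit_normal N T S \<psi> p)"


section \<open>Plane fronted waves\<close>

text \<open>The manifold \<open>\<real>\<^sup>2 \<times> M\<close> with its product charts \<open>((u, v), p) \<mapsto> ((u, v), cmap c p)\<close>;
  \<open>base_chart\<close> recovers \<open>c\<close> from such a chart.\<close>

definition product_chart ::
    "('m, 'e) chart \<Rightarrow> ((real \<times> real) \<times> 'm, (real \<times> real) \<times> 'e) chart" where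
  "product_chart c = (UNIV \<times> cdom c, map_prod id (cmap c))"

definition base_chart ::
    "((real \<times> real) \<times> 'm, (real \<times> real) \<times> 'e) chart \<Rightarrow> ('m, 'e) chart" where
  "base_chart d = (snd ` cdom d, \<lambda>p. snd (cmap d ((0, 0), p)))"

lemma base_chart_product_chart [simp]: "base_chart (product_chart c) = c"
  by (auto simp: base_chart_def product_chart_def cdom_def cmap_def intro!: prod_eqI)

text \<open>The metric is \<open>\<H> du\<otimes>du + du\<otimes>dv + dv\<otimes>du + g\<^sub>M\<close>, evaluated on \<open>(\<alpha>, \<beta>, \<xi>)\<close> and
  \<open>(\<alpha>', \<beta>', \<xi>')\<close>.\<close>

definition plane_fronted_wave ::
    "('m, 'e::euclidean_space) metric_manifold \<Rightarrow> (real \<Rightarrow> 'm \<Rightarrow> real) \<Rightarrow>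
     ((real \<times> real) \<times> 'm, (real \<times> real) \<times> 'e) metric_manifold" where
  "plane_fronted_wave M \<H> =
     \<lparr> mtop = prod_topology euclidean (mtop M),
       atlas = product_chart ` atlas M,
       metric = (\<lambda>d ((u, v), x) ((\<alpha>, \<beta>), \<xi>) ((\<alpha>', \<beta>'), \<xi>').
         \<H> u (cinv (base_chart d) x) * \<alpha> * \<alpha>' + \<alpha> * \<beta>' + \<beta> * \<alpha>' +
         metric M (base_chart d) x \<xi> \<xi>') \<rparr>"

text \<open>The coordinate vector field \<open>\<partial>\<^sub>v\<close>.\<close>

definition partial_v ::
    "((real \<times> real) \<times> 'm, (real \<times> real) \<times> 'e::euclidean_space) chart \<Rightarrow>
     (real \<times> real) \<times> 'e \<Rightarrow> (real \<times> real) \<times> 'e" where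
  "partial_v d y = ((0, 1), 0)"

end

theory Submission
  imports Defs
begin

text \<open>Every compact spacelike hypersurface of a plane fronted wave is excluded, by a first-order
  argument at an extremum of \<open>u\<close>.

  Since \<open>du(X) = \<langle>\<partial>\<^sub>v, X\<rangle>\<close>, the coordinate function \<open>u\<close> is a potential of the lightlike field
  \<open>\<partial>\<^sub>v\<close>, and the kernel of \<open>du\<close> is the degenerate hyperplane \<open>\<partial>\<^sub>v\<^sup>\<bottom>\<close>, which contains \<open>\<partial>\<^sub>v\<close>.
  On a nonempty compact hypersurface the continuous function \<open>u \<circ> \<psi>\<close> has a maximum. There its
  differential vanishes, so the tangent hyperplane of the hypersurface lies in the kernel of
  \<open>du\<close> and, by equality of dimensions, coincides with it. Hence the lightlike vector \<open>\<partial>\<^sub>v\<close> is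
  tangent to the hypersurface, which is impossible when the induced metric is Riemannian.

  The three ingredients are \<open>differential_zero_maxmin\<close> for the vanishing of the differential,
  \<open>hyperplane_vector_in_range\<close> for the comparison of dimensions, and \<open>partial_v_lightlike\<close>.\<close>

text \<open>This makes the coordinates around a point a full neighbourhood, which is what an argument
  with local extrema requires.\<close>

lemma open_local_dom:
  assumes c: "is_chart X c" and f: "continuous_map X Y f" and d: "openin Y (cdom d)"
  shows "open (local_dom c d f)"
proof -
  let ?U = "{p \<in> cdom c. f p \<in> cdom d}"
  have cdom: "openin X (cdom c)"
    using c by (simp add: is_chart_def)
  have "openin X (cdom c \<inter> {p \<in> topspace X. f p \<in> cdom d})"
    using cdom openin_continuous_map_preimage[OF f d] by (rule openin_Int)
  moreover have "cdom c \<inter> {p \<in> topspace X. f p \<in> cdom d} = ?U"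
    using openin_subset[OF cdom] by auto
  ultimately have "openin X ?U" by simp
  then have "openin (subtopology X (cdom c)) ?U"
    using cdom by (auto simp: openin_open_subtopology)
  moreover have "open_map (subtopology X (cdom c)) (top_of_set (cimg c)) (cmap c)"
    using c by (simp add: is_chart_def homeomorphic_imp_open_map)
  ultimately have "openin (top_of_set (cimg c)) (local_dom c d f)"
    by (simp add: open_map_def local_dom_def)
  then show ?thesis
    using c by (auto simp: is_chart_def intro: openin_open_trans)
qed

lemma cinv_cmap:
  assumes c: "is_chart X c" and p: "p \<in> cdom c"
  shows "cinv c (cmap c p) = p"
proof -
  have "topspace X \<inter> cdom c = cdom c"
    using c openin_subset by (fastforce simp: is_chart_def)
  then have "inj_on (cmap c) (cdom c)"
    using c homeomorphic_imp_injective_map unfolding is_chart_def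
    by (metis topspace_subtopology)
  with p show ?thesis by (simp add: cinv_def)
qed

lemma chart_at_in_atlas:
  assumes "c \<in> atlas N" and "p \<in> cdom c"
  shows "chart_at N p \<in> atlas N" and "p \<in> cdom (chart_at N p)"
proof -
  have "chart_at N p \<in> atlas N \<and> p \<in> cdom (chart_at N p)"
    unfolding chart_at_def by (rule someI[of _ c]) (simp add: assms)
  then show "chart_at N p \<in> atlas N" and "p \<in> cdom (chart_at N p)" by auto
qed

lemma smooth_on_imp_differentiable:
  assumes "smooth_on S f" and "x \<in> S"
  shows "f differentiable (at x)"
proof -
  have "Ck_on (Suc 0) S f" using assms(1) unfolding smooth_on_def by blast
  with assms(2) show ?thesis by simp
qed

text \<open>The range has the dimension of the hyperplane that contains it, so it is all of it.\<close>

lemma hyperplane_vector_in_range: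
  fixes L :: "'f::euclidean_space \<Rightarrow> 'g::euclidean_space"
  assumes L: "linear L" and inj: "inj L" and dim: "DIM('f) + 1 = DIM('g)"
    and a: "a \<noteq> 0" and range: "\<And>v. a \<bullet> L v = 0" and w: "a \<bullet> w = 0"
  shows "\<exists>v. L v = w"
proof -
  have "dim (range L) = DIM('f)"
    using dim_image_eq[OF L] inj by simp
  moreover have "dim {y. a \<bullet> y = 0} = DIM('g) - 1"
    using a by (rule dim_hyperplane)
  ultimately have "range L = {y. a \<bullet> y = 0}"
    using L dim range
    by (intro subspace_dim_equal) (auto simp: subspace_hyperplane linear_subspace_image)
  with w have "w \<in> range L" by simp
  then show ?thesis by blast
qed

lemma partial_v_lightlike:
  assumes M: "riemannian_manifold M" and c: "c \<in> atlas M" and y: "snd y \<in> cimg c"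
  shows "metric (plane_fronted_wave M \<H>) (product_chart c) y
           (partial_v (product_chart c) y) (partial_v (product_chart c) y) = 0"
proof -
  obtain u v x where y_eq: "y = ((u, v), x)" by (metis prod.exhaust)
  have "bilinear (metric M c x)"
    using M c y by (auto simp: riemannian_manifold_def riemannian_metric_def
        symmetric_tensor_def y_eq)
  then have "metric M c x 0 0 = 0" by (rule bilinear_lzero)
  then show ?thesis by (simp add: plane_fronted_wave_def partial_v_def y_eq)
qed

theorem no_compact_spacelike_hypersurface:
  fixes M :: "('m, 'e::euclidean_space) metric_manifold"
    and S :: "('s, 'f::euclidean_space) manifold"
  assumes M: "riemannian_manifold M"
    and compact: "compact_space (mtop S)"
    and hyp: "spacelike_hypersurface (plane_fronted_wave M \<H>) S \<psi>"
  shows False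
proof -
  let ?N = "plane_fronted_wave M \<H>"
  define u where "u = (\<lambda>q::(real \<times> real) \<times> 'm. fst (fst q))"
  have dim: "DIM('f) + 1 = DIM((real \<times> real) \<times> 'e)"
    and S: "smooth_manifold S" and \<psi>: "immersion S ?N \<psi>"
    and riem: "riemannian_metric S (induced_metric ?N \<psi>)"
    using hyp by (auto simp: spacelike_hypersurface_def)
  have cont: "continuous_map (mtop S) (mtop ?N) \<psi>"
    using \<psi> by (simp add: immersion_def smooth_map_def)
  have mtop_N: "mtop ?N = prod_topology euclidean (mtop M)"
    and atlas_N: "atlas ?N = product_chart ` atlas M"
    by (simp_all add: plane_fronted_wave_def)

  obtain p where p: "p \<in> topspace (mtop S)"
    and p_max: "\<And>q. q \<in> topspace (mtop S) \<Longrightarrow> u (\<psi> q) \<le> u (\<psi> p)"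
  proof -
    have "continuous_map (mtop S) euclidean (fst \<circ> \<psi>)"
      using cont unfolding mtop_N by (simp add: continuous_map_pairwise)
    then have "continuous_map (mtop S) euclidean (fst \<circ> (fst \<circ> \<psi>))"
      by (rule continuous_map_compose) (simp add: continuous_on_fst)
    then have "compactin euclidean ((fst \<circ> (fst \<circ> \<psi>)) ` topspace (mtop S))"
      using compact by (intro image_compactin) (auto simp: compact_space_def)
    then have "compact ((\<lambda>q. u (\<psi> q)) ` topspace (mtop S))"
      by (simp add: u_def comp_def)
    moreover have "topspace (mtop S) \<noteq> {}"
      using S by (simp add: smooth_manifold_def)
    ultimately show thesis
      using compact_attains_sup[of "(\<lambda>q. u (\<psi> q)) ` topspace (mtop S)"] that by auto
  qed

  obtain c where c: "c \<in> atlas S" "p \<in> cdom c"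
    using S p unfolding smooth_manifold_def by blast
  have c_chart: "is_chart (mtop S) c"
    using S c by (simp add: smooth_manifold_def)
  define d where "d = chart_at ?N (\<psi> p)"
  have "\<psi> p \<in> topspace (mtop ?N)"
    using cont p by (auto simp: continuous_map_def)
  then have "snd (\<psi> p) \<in> topspace (mtop M)"
    by (auto simp: mtop_N)
  then obtain b\<^sub>0 where "b\<^sub>0 \<in> atlas M" "snd (\<psi> p) \<in> cdom b\<^sub>0"
    using M unfolding riemannian_manifold_def smooth_manifold_def by blast
  then have "product_chart b\<^sub>0 \<in> atlas ?N" "\<psi> p \<in> cdom (product_chart b\<^sub>0)"
    by (auto simp: atlas_N cdom_def product_chart_def mem_Times_iff)
  note d_chart = chart_at_in_atlas[OF this, folded d_def]
  then obtain b where b: "b \<in> atlas M" "d = product_chart b"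
    by (auto simp: atlas_N)
  have d_open: "openin (mtop ?N) (cdom d)"
    using M b by (auto simp: riemannian_manifold_def smooth_manifold_def is_chart_def mtop_N
        cdom_def product_chart_def openin_prod_Times_iff)

  define x where "x = cmap c p"
  define F where "F = local_rep c d \<psi>"
  define L where "L = frechet_derivative F (at x)"
  have cinv_x: "cinv c x = p"
    using cinv_cmap[OF c_chart c(2)] by (simp add: x_def)
  have U_open: "open (local_dom c d \<psi>)"
    using open_local_dom[OF c_chart cont d_open] .
  have x_U: "x \<in> local_dom c d \<psi>"
    using c d_chart by (auto simp: local_dom_def x_def)
  have "F differentiable (at x)"
    using \<psi> c d_chart x_U unfolding F_def immersion_def smooth_map_def
    by (blast intro: smooth_on_imp_differentiable)
  then have F_deriv: "(F has_derivative L) (at x)"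
    by (simp add: L_def frechet_derivative_works)
  have L_inj: "inj L"
    using \<psi> c d_chart x_U by (auto simp: immersion_def L_def F_def)
  have F_u: "fst (fst (F y)) = u (\<psi> (cinv c y))" for y
    by (simp add: F_def local_rep_def b product_chart_def cmap_def u_def)

  have "(\<lambda>v. fst (fst (L v))) = (\<lambda>v. 0)"
  proof (rule differential_zero_maxmin[OF x_U U_open])
    show "((\<lambda>y. fst (fst (F y))) has_derivative (\<lambda>v. fst (fst (L v)))) (at x)"
      using F_deriv by (intro has_derivative_fst)
    have "fst (fst (F y)) \<le> fst (fst (F x))" if "y \<in> local_dom c d \<psi>" for y
    proof -
      from that obtain q where q: "q \<in> cdom c" "y = cmap c q"
        by (auto simp: local_dom_def)
      then have "q \<in> topspace (mtop S)"
        using c_chart openin_subset by (fastforce simp: is_chart_def)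
      with p_max show ?thesis
        using cinv_cmap[OF c_chart q(1)] q by (simp add: F_u cinv_x)
    qed
    then show "(\<forall>y\<in>local_dom c d \<psi>. fst (fst (F y)) \<le> fst (fst (F x))) \<or>
      (\<forall>y\<in>local_dom c d \<psi>. fst (fst (F x)) \<le> fst (fst (F y)))" by blast
  qed
  then have "fst (fst (L v)) = 0" for v by (rule fun_cong)
  \<comment> \<open>In coordinates, \<open>du\<close> is the Euclidean inner product with \<open>((1, 0), 0)\<close>.\<close>
  then have "((1, 0), 0) \<bullet> L v = 0" for v
    by (simp add: inner_prod_def)
  then obtain v where v: "L v = partial_v d (F x)"
    using hyperplane_vector_in_range[OF has_derivative_linear[OF F_deriv] L_inj dim,
        of "((1, 0), 0)" "partial_v d (F x)"]
    by (auto simp: partial_v_def zero_prod_def)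
  have "v \<noteq> 0"
    using v linear_0[OF has_derivative_linear[OF F_deriv]]
    by (auto simp: partial_v_def zero_prod_def)
  moreover have "x \<in> cimg c"
    using c by (simp add: x_def cimg_def)
  ultimately have "0 < induced_metric ?N \<psi> c x v v"
    using riem c by (simp add: riemannian_metric_def)
  moreover have "induced_metric ?N \<psi> c x v v =
      metric ?N d (F x) (partial_v d (F x)) (partial_v d (F x))"
    using v by (simp add: induced_metric_def Let_def cinv_x L_def F_def flip: d_def)
  moreover have "snd (F x) \<in> cimg b"
    using d_chart
    by (auto simp: F_def local_rep_def cinv_x b cimg_def product_chart_def cmap_def cdom_def)
  ultimately show False
    using partial_v_lightlike[OF M b(1), of "F x"] by (simp add: b)
qed

theorem corollary12:
  fixes M :: "('m, 'e::euclidean_space) metric_manifold"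
    and \<H> :: "real \<Rightarrow> 'm \<Rightarrow> real"
  assumes "riemannian_manifold M" and "connected_space (mtop M)"
    and "smooth_function (plane_fronted_wave M \<H>) (\<lambda>((u, v), p). \<H> u p)"
  shows "\<not> (\<exists>(S :: ('s, 'f::euclidean_space) manifold) \<psi>.
            compact_space (mtop S) \<and>
            spacelike_hypersurface (plane_fronted_wave M \<H>) S \<psi> \<and>
            ((\<forall>p\<in>topspace (mtop S).
                mean_curvature (plane_fronted_wave M \<H>) partial_v S \<psi> p \<ge> 0) \<or>
             (\<forall>p\<in>topspace (mtop S).
                mean_curvature (plane_fronted_wave M \<H>) partial_v S \<psi> p \<le> 0)))"
proof (rule notI, elim exE conjE)
  fix S :: "('s, 'f) manifold" and \<psi>
  assume "compact_space (mtop S)" and "spacelike_hypersurface (plane_fronted_wave M \<H>) S \<psi>"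
  with assms(1) show False by (rule no_compact_spacelike_hypersurface)
qed

end
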